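(* Let $t$ be an integer and let $G$ be a graph. (1) If every induced bipartite subgraph of $G$, with bipartition $(A,B)$, has a proper odd coloring $c$ with $|c(A)|\le t$ and $|c(B)|\le t$, then $\chi_{\mathrm{o}}(G)\le t^2\chi(G)-2t(t-1)$. (2) If every induced bipartite subgraph of $G$, with bipartition $(A,B)$, has a proper conflict-free coloring $c$ with $|c(A)|\le t$ and $|c(B)|\le t$, then $\chi_{\mathrm{pcf}}(G)\le t^2\chi(G)-2t(t-1)$.
   Context: $\chi(G)$ is the (proper) chromatic number of $G$. An $(A,B)$-bipartite graph is a bipartite graph whose vertex set is partitioned into independent sets $A$ and $B$. A proper odd coloring of a graph is a proper vertex coloring in which, for every non-isolated vertex, some color appears an odd number of times among its neighbors. A proper conflict-free coloring is a proper vertex coloring in which, for every non-isolated vertex, some color appears exactly once among its neighbors. $\chi_{\mathrm{o}}(G)$ (resp. $\chi_{\mathrm{pcf}}(G)$) is the least positive integer $k$ such that $G$ has a proper odd (resp. proper conflict-free) coloring with $k$ colors. For a coloring $c$ and a vertex set $Z$, $c(Z)$ is the set of colors that $c$ uses on $Z$.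
   Formalization: The formal theorem assumes that G has at least one edge, or that G is nonempty and t ≤ 1; without this the claim fails, e.g. for an edgeless nonempty G with t = 2, where the bound is 0 but the chromatic numbers are 1. *)

theory Defs
  imports Complex_Main "Graph_Theory.Digraph_Component"
begin

text \<open>
  A finite simple graph is a \<^locale>\<open>graph\<close> of the Graph_Theory entry: a finite, loop-free,
  symmetric digraph without parallel arcs. Each edge is thus a pair of opposite arcs, and
  adjacency is the relation \<^const>\<open>dominates\<close>.
\<close>

definition neighborhood :: "('a, 'b) pre_digraph \<Rightarrow> 'a \<Rightarrow> 'a set" where
  "neighborhood G v = {u. v \<rightarrow>\<^bsub>G\<^esub> u}"

definition independent_set :: "('a, 'b) pre_digraph \<Rightarrow> 'a set \<Rightarrow> bool" where
  "independent_set G S \<longleftrightarrow> S \<subseteq> verts G \<and> (\<forall>u\<in>S. \<forall>v\<in>S. \<not> u \<rightarrow>\<^bsub>G\<^esub> v)"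

text \<open>One of the two sides may be empty.\<close>

definition bipartite_graph :: "('a, 'b) pre_digraph \<Rightarrow> 'a set \<Rightarrow> 'a set \<Rightarrow> bool" where
  "bipartite_graph G A B \<longleftrightarrow>
     A \<union> B = verts G \<and> A \<inter> B = {} \<and> independent_set G A \<and> independent_set G B"

definition proper_coloring :: "('a, 'b) pre_digraph \<Rightarrow> ('a \<Rightarrow> nat) \<Rightarrow> bool" where
  "proper_coloring G c \<longleftrightarrow>
     (\<forall>u\<in>verts G. \<forall>v\<in>verts G. u \<rightarrow>\<^bsub>G\<^esub> v \<longrightarrow> c u \<noteq> c v)"

definition proper_odd_coloring :: "('a, 'b) pre_digraph \<Rightarrow> ('a \<Rightarrow> nat) \<Rightarrow> bool" where
  "proper_odd_coloring G c \<longleftrightarrow> proper_coloring G c \<and>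
     (\<forall>v\<in>verts G. neighborhood G v \<noteq> {} \<longrightarrow>
        (\<exists>i. odd (card {u \<in> neighborhood G v. c u = i})))"

definition proper_cf_coloring :: "('a, 'b) pre_digraph \<Rightarrow> ('a \<Rightarrow> nat) \<Rightarrow> bool" where
  "proper_cf_coloring G c \<longleftrightarrow> proper_coloring G c \<and>
     (\<forall>v\<in>verts G. neighborhood G v \<noteq> {} \<longrightarrow>
        (\<exists>i. card {u \<in> neighborhood G v. c u = i} = 1))"

text \<open>A coloring with \<open>k\<close> colors takes values in the palette \<open>{..<k}\<close>; not every color of the
  palette has to be used.\<close>

definition chromatic_number :: "('a, 'b) pre_digraph \<Rightarrow> nat" where
  "chromatic_number G = (LEAST k. \<exists>c. proper_coloring G c \<and> c ` verts G \<subseteq> {..<k})"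

definition odd_chromatic_number :: "('a, 'b) pre_digraph \<Rightarrow> nat" where
  "odd_chromatic_number G =
     (LEAST k. 0 < k \<and> (\<exists>c. proper_odd_coloring G c \<and> c ` verts G \<subseteq> {..<k}))"

definition pcf_chromatic_number :: "('a, 'b) pre_digraph \<Rightarrow> nat" where
  "pcf_chromatic_number G =
     (LEAST k. 0 < k \<and> (\<exists>c. proper_cf_coloring G c \<and> c ` verts G \<subseteq> {..<k}))"

end

theory Submission
  imports Defs
begin

text \<open>
  Take an optimal proper coloring with classes \<open>V\<^sub>0, \<dots>, V\<^sub>k\<^sub>-\<^sub>1\<close>, chosen greedily, so that every vertex
  outside \<open>V\<^sub>0\<close> has a neighbor in the preceding class. A non-isolated vertex of \<open>V\<^sub>0\<close> without
  neighbors in \<open>V\<^sub>1\<close> is moved to \<open>V\<^sub>j\<^sub>-\<^sub>1\<close>, where \<open>V\<^sub>j\<close> is the first class in which it has a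
  neighbor. Now every non-isolated vertex has a neighbor in a class that is consecutive to its own.
  Color each bipartite graph induced by \<open>V\<^sub>i \<union> V\<^sub>i\<^sub>+\<^sub>1\<close> by the hypothesis, and give each vertex its class
  together with its at most two colors. The first and the last class receive at most
  \<open>t\<close> colors, the other ones at most \<open>t\<^sup>2\<close>. A witness survives the refinement of a coloring because
  a sum of numbers that is odd (or equal to 1) has a summand that is odd (or equal to 1).
\<close>

section \<open>Predicates on color-class sizes that survive refinement\<close>

text \<open>\<open>P\<close> will be \<open>odd\<close> or equality with 1, so that both halves of
  the theorem come from one argument.\<close>

definition witness_coloring ::
    "(nat \<Rightarrow> bool) \<Rightarrow> ('a, 'b) pre_digraph \<Rightarrow> ('a \<Rightarrow> nat) \<Rightarrow> bool" where
  "witness_coloring P G c \<longleftrightarrow> proper_coloring G c \<and>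
     (\<forall>v\<in>verts G. neighborhood G v \<noteq> {} \<longrightarrow>
        (\<exists>i. P (card {u \<in> neighborhood G v. c u = i})))"

definition splitting :: "(nat \<Rightarrow> bool) \<Rightarrow> bool" where
  "splitting P \<longleftrightarrow> \<not> P 0 \<and> (\<forall>m n. P (m + n) \<longrightarrow> P m \<or> P n)"

lemma splitting_sum:
  assumes "splitting P" "finite I" "P (\<Sum>i\<in>I. f i)"
  shows "\<exists>i\<in>I. P (f i)"
  using assms(2,3)
proof (induction I rule: finite_induct)
  case empty
  then show ?case using assms(1) by (simp add: splitting_def)
next
  case (insert x F)
  then have "P (f x) \<or> P (\<Sum>i\<in>F. f i)"
    using assms(1) by (simp add: splitting_def)
  then show ?case using insert by auto
qed

text \<open>The fibers of \<open>g\<close> partition \<open>S\<close>, so their sizes add up to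
  \<open>card S\<close>. Hence a color class satisfying \<open>P\<close> still contains one after
  its color has been split further.\<close>

lemma splitting_refine:
  assumes "splitting P" "finite S" "P (card S)"
  shows "\<exists>w\<in>S. P (card {u \<in> S. g u = g w})"
proof -
  have "card S = (\<Sum>y\<in>g ` S. card {u \<in> S. g u = y})"
    using sum.image_gen[OF assms(2), of "\<lambda>_. 1::nat" g] by simp
  from subst[of _ _ P, OF this assms(3)]
  have "P (\<Sum>y\<in>g ` S. card {u \<in> S. g u = y})" .
  from splitting_sum[OF assms(1) finite_imageI[OF assms(2)] this]
  show ?thesis by auto
qed

lemma (in digraph) neighborhood_subset_verts: "neighborhood G v \<subseteq> verts G"
  by (auto simp: neighborhood_def adj_in_verts)

lemma (in digraph) finite_neighborhood: "finite (neighborhood G v)"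
  using neighborhood_subset_verts finite_verts by (rule finite_subset)

lemma induce_subgraph_adj:
  "u \<rightarrow>\<^bsub>G \<restriction> S\<^esub> v \<longleftrightarrow> u \<in> S \<and> v \<in> S \<and> u \<rightarrow>\<^bsub>G\<^esub> v"
  by (auto simp: arcs_ends_def arc_to_ends_def image_iff)

lemma neighborhood_induce:
  assumes "v \<in> S"
  shows "neighborhood (G \<restriction> S) v = {u \<in> neighborhood G v. u \<in> S}"
  using assms by (auto simp: neighborhood_def induce_subgraph_adj)

lemma (in wf_digraph) proper_coloringI:
  assumes "\<And>u v. u \<rightarrow>\<^bsub>G\<^esub> v \<Longrightarrow> c u \<noteq> c v"
  shows "proper_coloring G c"
  using assms by (auto simp: proper_coloring_def)

lemma (in wf_digraph) proper_coloringD: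
  assumes "proper_coloring G c" "u \<rightarrow>\<^bsub>G\<^esub> v"
  shows "c u \<noteq> c v"
  using assms adj_in_verts by (auto simp: proper_coloring_def)

section \<open>Optimal colorings with neighbors in consecutive classes\<close>

text \<open>An injective numbering of the vertices is a proper coloring, so the \<open>LEAST\<close>
  is attained.\<close>

lemma (in graph) chromatic_number_coloring:
  "\<exists>c. proper_coloring G c \<and> c ` verts G \<subseteq> {..<chromatic_number G}"
proof -
  obtain h where h: "bij_betw h (verts G) {0..<card (verts G)}"
    using ex_bij_betw_finite_nat[OF finite_verts] by blast
  have "h u \<noteq> h v" if "u \<rightarrow>\<^bsub>G\<^esub> v" for u v
    using that h adj_not_same adj_in_verts[OF that] by (metis bij_betw_def inj_on_def)
  then have "proper_coloring G h" by (rule proper_coloringI)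
  moreover have "h ` verts G \<subseteq> {..<card (verts G)}"
    using h by (auto simp: bij_betw_def)
  ultimately have "\<exists>k c. proper_coloring G c \<and> c ` verts G \<subseteq> {..<k}" by blast
  then show ?thesis unfolding chromatic_number_def by (rule LeastI_ex)
qed

text \<open>A coloring that minimizes the sum of all colors works: a vertex with no neighbor of some
  smaller color could take that color, which lowers the sum.\<close>

lemma (in graph) greedy_coloring:
  assumes "proper_coloring G c" "c ` verts G \<subseteq> {..<k}"
  obtains f where "proper_coloring G f" "f ` verts G \<subseteq> {..<k}"
    "\<And>v j. v \<in> verts G \<Longrightarrow> j < f v \<Longrightarrow> \<exists>u. v \<rightarrow>\<^bsub>G\<^esub> u \<and> f u = j"
proof -
  let ?Q = "\<lambda>f::'a \<Rightarrow> nat. proper_coloring G f \<and> f ` verts G \<subseteq> {..<k}"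
  obtain f where f: "?Q f" and min: "\<And>g. ?Q g \<Longrightarrow> (\<Sum>v\<in>verts G. f v) \<le> (\<Sum>v\<in>verts G. g v)"
    using ex_has_least_nat[of ?Q c "\<lambda>f. \<Sum>v\<in>verts G. f v"] assms by blast
  have "\<exists>u. v \<rightarrow>\<^bsub>G\<^esub> u \<and> f u = j" if v: "v \<in> verts G" "j < f v" for v j
  proof (rule ccontr)
    assume no: "\<not> ?thesis"
    have "(f(v := j)) x \<noteq> (f(v := j)) y" if "x \<rightarrow>\<^bsub>G\<^esub> y" for x y
      using no that f proper_coloringD[of f x y] adj_not_same graph_symmetric[OF that]
      by (auto simp: fun_upd_def)
    then have "proper_coloring G (f(v := j))" by (rule proper_coloringI)
    moreover have "(f(v := j)) ` verts G \<subseteq> {..<k}"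
      using f v by (fastforce simp: image_subset_iff)
    ultimately have "(\<Sum>x\<in>verts G. f x) \<le> (\<Sum>x\<in>verts G. (f(v := j)) x)"
      using min by blast
    moreover have "(\<Sum>x\<in>verts G. (f(v := j)) x) < (\<Sum>x\<in>verts G. f x)"
      using v by (intro sum_strict_mono_ex1) auto
    ultimately show False by simp
  qed
  with f that show thesis by blast
qed

text \<open>Only vertices \<open>v\<close> of class 0 move. Class 0 is independent, so their
  neighbors stay put, all in classes at least \<open>m v\<close>; hence no neighbor of
  \<open>v\<close> is in class \<open>m v - 1\<close>.\<close>

lemma (in graph) consecutive_coloring:
  obtains f where "proper_coloring G f" "f ` verts G \<subseteq> {..<chromatic_number G}"
    "\<And>v. neighborhood G v \<noteq> {} \<Longrightarrow> \<exists>u. v \<rightarrow>\<^bsub>G\<^esub> u \<and> (f u = Suc (f v) \<or> f v = Suc (f u))"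
proof -
  let ?k = "chromatic_number G"
  obtain c where "proper_coloring G c" "c ` verts G \<subseteq> {..<?k}"
    using chromatic_number_coloring by blast
  then obtain g where g: "proper_coloring G g" "g ` verts G \<subseteq> {..<?k}"
    and greedy: "\<And>v j. v \<in> verts G \<Longrightarrow> j < g v \<Longrightarrow> \<exists>u. v \<rightarrow>\<^bsub>G\<^esub> u \<and> g u = j"
    by (rule greedy_coloring) blast
  have gne: "g u \<noteq> g v" if "u \<rightarrow>\<^bsub>G\<^esub> v" for u v
    using proper_coloringD[OF g(1) that] .
  define m where "m v = (LEAST j. \<exists>u. v \<rightarrow>\<^bsub>G\<^esub> u \<and> g u = j)" for v
  have m_le: "m v \<le> g u" if "v \<rightarrow>\<^bsub>G\<^esub> u" for u v
    unfolding m_def using that by (intro Least_le) blast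
  have m_ex: "\<exists>u. v \<rightarrow>\<^bsub>G\<^esub> u \<and> g u = m v" if "v \<rightarrow>\<^bsub>G\<^esub> w" for v w
  proof -
    have "\<exists>j u. v \<rightarrow>\<^bsub>G\<^esub> u \<and> g u = j" using that by blast
    from LeastI_ex[OF this] show ?thesis by (simp add: m_def)
  qed
  \<comment> \<open>If \<open>v\<close> has a neighbor in class 1, then \<open>m v - 1 = 0\<close>
    and \<open>v\<close> stays. Isolated vertices are excluded because \<open>m v\<close> is a
    \<open>LEAST\<close> over an empty set for them.\<close>
  define f where
    "f v = (if g v = 0 \<and> neighborhood G v \<noteq> {} then m v - 1 else g v)" for v
  have f0: "f v = m v - 1" "m v > 0" if "g v = 0" "v \<rightarrow>\<^bsub>G\<^esub> u" for u v
  proof -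
    show "f v = m v - 1" using that by (auto simp: f_def neighborhood_def)
    show "m v > 0" using m_ex[OF that(2)] gne that(1) by force
  qed
  have f1: "f v = g v" if "g v > 0" for v
    using that by (simp add: f_def)
  have ne: "f u \<noteq> f v" if "u \<rightarrow>\<^bsub>G\<^esub> v" "g u \<le> g v" for u v
  proof (cases "g u = 0")
    case True
    with gne that have "g v > 0" by fastforce
    \<comment> \<open>Here \<open>f u = m u - 1 < m u \<le> g v = f v\<close>.\<close>
    with True that m_le[OF that(1)] f0[OF True that(1)] f1 show ?thesis by auto
  next
    case False
    with that gne f1 show ?thesis by auto
  qed
  have "f u \<noteq> f v" if "u \<rightarrow>\<^bsub>G\<^esub> v" for u v
    using ne[of u v] ne[of v u] that graph_symmetric[OF that] by (metis nle_le)
  then have proper: "proper_coloring G f" by (rule proper_coloringI)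
  have range: "f v < ?k" if "v \<in> verts G" for v
  proof (cases "g v = 0 \<and> neighborhood G v \<noteq> {}")
    case True
    then obtain u where u: "v \<rightarrow>\<^bsub>G\<^esub> u" by (auto simp: neighborhood_def)
    then have "g u < ?k" using g(2) adj_in_verts(2)[OF u] by auto
    with m_le[OF u] f0[OF _ u] True show ?thesis by force
  next
    case False
    then show ?thesis using g(2) that by (auto simp: f_def)
  qed
  have consec: "\<exists>u. v \<rightarrow>\<^bsub>G\<^esub> u \<and> (f u = Suc (f v) \<or> f v = Suc (f u))"
    if nonisol: "neighborhood G v \<noteq> {}" for v
  proof -
    obtain w where w: "v \<rightarrow>\<^bsub>G\<^esub> w" using nonisol by (auto simp: neighborhood_def)
    show ?thesis
    proof (cases "g v = 0")
      case True
      obtain u where u: "v \<rightarrow>\<^bsub>G\<^esub> u" "g u = m v" using m_ex[OF w] by blast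
      have "f u = Suc (f v)" using f0[OF True w] f1[of u] u by simp
      with u show ?thesis by blast
    next
      case False
      obtain u where u: "v \<rightarrow>\<^bsub>G\<^esub> u" "g u = g v - 1"
        using greedy[OF adj_in_verts(1)[OF w], of "g v - 1"] False by auto
      \<comment> \<open>Only a vertex of class 0 can move; if \<open>g u = 0\<close>, then
        \<open>g v = 1\<close>, so \<open>m u \<le> 1\<close> and \<open>u\<close> stays.\<close>
      have "f u = g u"
      proof (cases "g u = 0")
        case True
        have "u \<rightarrow>\<^bsub>G\<^esub> v" using graph_symmetric[OF u(1)] .
        then have "m u \<le> 1" using m_le[of u v] u False True by simp
        then show ?thesis using f0[OF True \<open>u \<rightarrow>\<^bsub>G\<^esub> v\<close>] True by simp
      qed (simp add: f1)
      then show ?thesis using u False f1[of v] by force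
    qed
  qed
  show thesis using that[of f] proper range consec by blast
qed

section \<open>Gluing the colorings of the bipartite pieces\<close>

text \<open>The numbering \<open>h\<close> is injective only on colors in use, which is why the
  witness has to be the color \<open>c w\<close> of a vertex.\<close>

lemma (in graph) relabel_coloring:
  fixes c :: "'a \<Rightarrow> 'c"
  assumes "\<And>u v. u \<rightarrow>\<^bsub>G\<^esub> v \<Longrightarrow> c u \<noteq> c v"
    and "\<And>v. neighborhood G v \<noteq> {} \<Longrightarrow>
      \<exists>w\<in>verts G. P (card {u \<in> neighborhood G v. c u = c w})"
  shows "\<exists>d. witness_coloring P G d \<and> d ` verts G \<subseteq> {..<card (c ` verts G)}"
proof -
  obtain h where h: "bij_betw h (c ` verts G) {0..<card (c ` verts G)}"
    using ex_bij_betw_finite_nat finite_verts by blast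
  have inj: "h (c u) = h (c v) \<longleftrightarrow> c u = c v" if "u \<in> verts G" "v \<in> verts G" for u v
    using h that by (auto simp: bij_betw_def inj_on_def)
  have "witness_coloring P G (h \<circ> c)"
    unfolding witness_coloring_def
  proof (intro conjI ballI impI proper_coloringI)
    fix u v assume "u \<rightarrow>\<^bsub>G\<^esub> v"
    then show "(h \<circ> c) u \<noteq> (h \<circ> c) v" using assms(1) inj adj_in_verts by simp
  next
    fix v assume "neighborhood G v \<noteq> {}"
    then obtain w where w: "w \<in> verts G" "P (card {u \<in> neighborhood G v. c u = c w})"
      using assms(2) by blast
    moreover have "{u \<in> neighborhood G v. (h \<circ> c) u = h (c w)}
        = {u \<in> neighborhood G v. c u = c w}"
      using inj w(1) neighborhood_subset_verts by auto
    ultimately show "\<exists>i. P (card {u \<in> neighborhood G v. (h \<circ> c) u = i})" by metis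
  qed
  moreover have "(h \<circ> c) ` verts G \<subseteq> {..<card (c ` verts G)}"
    using h by (auto simp: bij_betw_def)
  ultimately show ?thesis by blast
qed

text \<open>Summand \<open>i\<close> bounds the color pairs in class \<open>i\<close>: up to
  \<open>T\<close> colors from each of the two pieces containing the class, and a factor 1 for the
  piece missing at either end.\<close>

lemma (in graph) witness_coloring_from_bipartite:
  assumes P: "splitting P"
    and bip: "\<And>H A B. induced_subgraph H G \<Longrightarrow> bipartite_graph H A B \<Longrightarrow>
      \<exists>c. witness_coloring P H c \<and> card (c ` A) \<le> T \<and> card (c ` B) \<le> T"
    and k: "k = chromatic_number G"
  shows "\<exists>d n. witness_coloring P G d \<and> d ` verts G \<subseteq> {..<n} \<and>
    n \<le> (\<Sum>i<k. (if i = 0 then 1 else T) * (if Suc i = k then 1 else T))"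
proof -
  obtain f where f: "proper_coloring G f" "f ` verts G \<subseteq> {..<k}"
    and consec: "\<And>v. neighborhood G v \<noteq> {} \<Longrightarrow>
      \<exists>u. v \<rightarrow>\<^bsub>G\<^esub> u \<and> (f u = Suc (f v) \<or> f v = Suc (f u))"
    unfolding k by (rule consecutive_coloring) blast
  define V where "V i = {v \<in> verts G. f v = i}" for i
  \<comment> \<open>No bound on \<open>i\<close> is imposed: classes from \<open>k\<close> on are
    empty, and a side may be empty.\<close>
  have "\<exists>c. witness_coloring P (G \<restriction> (V i \<union> V (Suc i))) c \<and>
      card (c ` V i) \<le> T \<and> card (c ` V (Suc i)) \<le> T" for i
  proof (rule bip)
    show "induced_subgraph (G \<restriction> (V i \<union> V (Suc i))) G"
      by (rule induced_induce) (auto simp: V_def)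
    have "independent_set (G \<restriction> (V i \<union> V (Suc i))) (V j)" if "j = i \<or> j = Suc i" for j
      using that proper_coloringD[OF f(1)]
      by (auto simp: independent_set_def induce_subgraph_adj V_def) metis+
    then show "bipartite_graph (G \<restriction> (V i \<union> V (Suc i))) (V i) (V (Suc i))"
      by (auto simp: bipartite_graph_def V_def)
  qed
  then obtain c where c: "\<And>i. witness_coloring P (G \<restriction> (V i \<union> V (Suc i))) (c i)"
    and card_c: "\<And>i. card (c i ` V i) \<le> T" "\<And>i. card (c i ` V (Suc i)) \<le> T"
    by metis
  \<comment> \<open>\<open>l\<close> and \<open>r\<close> are the colors in the pieces shared with
    the preceding and the following class; the constant 0 replaces the missing piece at either
    end.\<close>
  define l where "l v = (if f v = 0 then 0 else c (f v - 1) v)" for v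
  define r where "r v = (if Suc (f v) = k then 0 else c (f v) v)" for v
  define e where "e v = (f v, l v, r v)" for v
  have witness: "\<exists>w\<in>verts G. P (card {u \<in> neighborhood G v. e u = e w})"
    if nonisol: "neighborhood G v \<noteq> {}" for v
  proof -
    obtain x where x: "v \<rightarrow>\<^bsub>G\<^esub> x" "f x = Suc (f v) \<or> f v = Suc (f x)"
      using consec[OF nonisol] by blast
    have not_same: "f u \<noteq> f v" if "u \<in> neighborhood G v" for u
      using that proper_coloringD[OF f(1), of v u] by (auto simp: neighborhood_def)
    note in_verts = adj_in_verts[OF x(1)]
    define i where "i = min (f v) (f x)"
    have i: "f v = i \<and> f x = Suc i \<or> f v = Suc i \<and> f x = i"
      using x(2) by (auto simp: i_def)
    have ik: "Suc i < k" using i f(2) in_verts by auto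
    let ?H = "G \<restriction> (V i \<union> V (Suc i))"
    have v: "v \<in> V i \<union> V (Suc i)" and "x \<in> neighborhood ?H v"
      using i in_verts x(1) by (auto simp: V_def neighborhood_def induce_subgraph_adj)
    then obtain a where "P (card {u \<in> neighborhood ?H v. c i u = a})"
      using c[of i] unfolding witness_coloring_def induce_subgraph_verts by blast
    \<comment> \<open>As \<open>f\<close> is proper, \<open>v\<close> has no neighbor in its own
      class, so its neighbors in \<open>?H\<close> are those in the class of
      \<open>x\<close>.\<close>
    moreover have "{u \<in> neighborhood ?H v. c i u = a}
        = {u \<in> neighborhood G v. f u = f x \<and> c i u = a}" (is "_ = ?S")
      using v i neighborhood_subset_verts not_same
      by (auto simp: neighborhood_induce V_def)
    ultimately have "P (card ?S)" by simp
    moreover have "finite ?S" using finite_neighborhood by simp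
    ultimately obtain w where w: "w \<in> ?S" "P (card {u \<in> ?S. e u = e w})"
      using splitting_refine[OF P] by blast
    \<comment> \<open>On the class of \<open>x\<close>, \<open>c i\<close> is a component of
      \<open>e\<close>, so neighbors of \<open>v\<close> that share the \<open>e\<close>-color of
      \<open>w\<close> all lie in \<open>?S\<close>. \<open>Suc i < k\<close> rules out the default
      value of \<open>r\<close>.\<close>
    have "c i u = (if f u = i then r u else l u)" if "f u = f x" for u
      using that i ik by (auto simp: l_def r_def)
    then have "{u \<in> ?S. e u = e w} = {u \<in> neighborhood G v. e u = e w}"
      using w(1) by (auto simp: e_def)
    with w(2) have "P (card {u \<in> neighborhood G v. e u = e w})" by (simp only:)
    moreover have "w \<in> verts G" using w(1) neighborhood_subset_verts by blast
    ultimately show ?thesis by blast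
  qed
  have "e u \<noteq> e v" if "u \<rightarrow>\<^bsub>G\<^esub> v" for u v
    using proper_coloringD[OF f(1) that] by (simp add: e_def)
  then obtain d where d: "witness_coloring P G d" "d ` verts G \<subseteq> {..<card (e ` verts G)}"
    using relabel_coloring[of e P] witness by blast
  have fin: "finite (V i)" for i using finite_verts by (simp add: V_def)
  have "card (e ` verts G) \<le> card (\<Union>i<k. {i} \<times> l ` V i \<times> r ` V i)"
    using fin f(2) by (intro card_mono) (auto simp: e_def V_def)
  also have "\<dots> \<le> (\<Sum>i<k. card ({i} \<times> l ` V i \<times> r ` V i))"
    by (rule card_UN_le) simp
  also have "\<dots> \<le> (\<Sum>i<k. (if i = 0 then 1 else T) * (if Suc i = k then 1 else T))"
  proof (rule sum_mono)
    fix i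
    have "card (l ` V i) \<le> (if i = 0 then 1 else T)"
    proof (cases i)
      case 0
      then have "l ` V i \<subseteq> {0}" by (auto simp: l_def V_def)
      then show ?thesis using 0 card_mono[of "{0}" "l ` V i"] by simp
    next
      case (Suc j)
      then have "l ` V i = c j ` V (Suc j)" by (intro image_cong) (auto simp: l_def V_def)
      then show ?thesis using Suc card_c by simp
    qed
    moreover have "card (r ` V i) \<le> (if Suc i = k then 1 else T)"
    proof (cases "Suc i = k")
      case True
      then have "r ` V i \<subseteq> {0}" by (auto simp: r_def V_def)
      then show ?thesis using True card_mono[of "{0}" "r ` V i"] by simp
    next
      case False
      then have "r ` V i = c i ` V i" by (intro image_cong) (auto simp: r_def V_def)
      then show ?thesis using False card_c by simp
    qed
    ultimately show "card ({i} \<times> l ` V i \<times> r ` V i)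
        \<le> (if i = 0 then 1 else T) * (if Suc i = k then 1 else T)"
      by (simp add: card_cartesian_product mult_le_mono del: One_nat_def)
  qed
  finally show ?thesis using d by blast
qed

section \<open>Counting the colors\<close>

text \<open>The end classes give \<open>T\<close> each, the \<open>n\<close> inner ones
  \<open>T * T\<close>. For \<open>k = n + 2\<close> the total is the desired
  \<open>T^2 * k - 2 * T * (T - 1)\<close>.\<close>

lemma sum_class_sizes:
  "(\<Sum>i<Suc (Suc n). (if i = 0 then 1 else T) * (if Suc i = Suc (Suc n) then 1 else T))
     = 2 * T + n * (T * T)" for T :: nat
proof -
  let ?g = "\<lambda>i. (if i = 0 then 1 else T) * (if Suc i = Suc (Suc n) then 1 else T)"
  have "(\<Sum>i<n. ?g (Suc i)) = (\<Sum>i<n. T * T)" by (rule sum.cong) auto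
  moreover have "(\<Sum>i<Suc (Suc n). ?g i) = ?g 0 + ((\<Sum>i<n. ?g (Suc i)) + ?g (Suc n))"
    by (simp only: sum.lessThan_Suc_shift[of _ "Suc n"] sum.lessThan_Suc[of _ n])
  ultimately show ?thesis by simp
qed

text \<open>\<open>nontrivial\<close> guards the degenerate cases: the bound is
  \<open>-2 * t * (t - 1)\<close> for the empty graph and \<open>1 - (t - 1)^2\<close> for other
  edgeless graphs, while the number of colors is positive.\<close>

lemma (in graph) witness_chromatic_bound:
  fixes t :: int
  assumes P: "splitting P"
    and nontrivial: "arcs G \<noteq> {} \<or> (verts G \<noteq> {} \<and> t \<le> 1)"
    and bip: "\<forall>H A B. induced_subgraph H G \<and> bipartite_graph H A B \<longrightarrow>
      (\<exists>c. witness_coloring P H c \<and> int (card (c ` A)) \<le> t \<and> int (card (c ` B)) \<le> t)"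
  shows "int (LEAST k. 0 < k \<and> (\<exists>c. witness_coloring P G c \<and> c ` verts G \<subseteq> {..<k}))
    \<le> t\<^sup>2 * int (chromatic_number G) - 2 * t * (t - 1)"
proof -
  obtain v where v: "v \<in> verts G" using nontrivial tail_in_verts by blast
  \<comment> \<open>The hypothesis for a one-vertex subgraph with empty second side forces
    \<open>t \<ge> 1\<close>.\<close>
  have "independent_set (G \<restriction> {v}) {v}" "independent_set (G \<restriction> {v}) {}"
    using adj_not_same by (auto simp: independent_set_def induce_subgraph_adj)
  then have "bipartite_graph (G \<restriction> {v}) {v} {}" by (simp add: bipartite_graph_def)
  moreover have "induced_subgraph (G \<restriction> {v}) G" using v by (intro induced_induce) auto
  ultimately obtain c :: "'a \<Rightarrow> nat" where "int (card (c ` {v})) \<le> t" using bip by meson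
  then have t: "1 \<le> t" by simp
  define T where "T = nat t"
  have T: "t = int T" using t by (auto simp: T_def)
  define k where "k = chromatic_number G"
  have "\<exists>c. witness_coloring P H c \<and> card (c ` A) \<le> T \<and> card (c ` B) \<le> T"
    if "induced_subgraph H G" "bipartite_graph H A B" for H A B
    using bip that unfolding T by (meson of_nat_le_iff)
  then obtain d n where d: "witness_coloring P G d" "d ` verts G \<subseteq> {..<n}"
    and n: "n \<le> (\<Sum>i<k. (if i = 0 then 1 else T) * (if Suc i = k then 1 else T))"
    using witness_coloring_from_bipartite[OF P _ k_def] by blast
  have "0 < n" using d(2) v by auto
  then have "(LEAST k. 0 < k \<and> (\<exists>c. witness_coloring P G c \<and> c ` verts G \<subseteq> {..<k})) \<le> n"
    using d by (intro Least_le) blast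
  moreover have "int n \<le> t\<^sup>2 * int k - 2 * t * (t - 1)"
  proof -
    obtain c where c: "proper_coloring G c" "c ` verts G \<subseteq> {..<k}"
      using chromatic_number_coloring unfolding k_def by blast
    consider "k = 0" | "k = 1" | j where "k = Suc (Suc j)" by (metis One_nat_def not0_implies_Suc)
    then show ?thesis
    proof cases
      case 1
      then show ?thesis using c(2) v by auto
    next
      case 2
      \<comment> \<open>A single color excludes arcs, so \<open>nontrivial\<close> leaves only
        \<open>t = 1\<close>, where the sum and the bound are both 1.\<close>
      have "arcs G = {}"
      proof (rule ccontr)
        assume "arcs G \<noteq> {}"
        then obtain a where "a \<in> arcs G" by blast
        then have "tail G a \<rightarrow>\<^bsub>G\<^esub> head G a" by (auto simp: arcs_ends_conv)
        from proper_coloringD[OF c(1) this] adj_in_verts[OF this] show False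
          using c(2) 2 by (simp add: image_subset_iff)
      qed
      then have "t = 1" using nontrivial t by auto
      then show ?thesis using n 2 by simp
    next
      case 3
      then have "n \<le> 2 * T + j * (T * T)" using n sum_class_sizes by simp
      then have "int n \<le> 2 * t + int j * (t * t)"
        unfolding T by (simp flip: of_nat_mult of_nat_add)
      then show ?thesis using 3 by (simp add: power2_eq_square algebra_simps)
    qed
  qed
  ultimately show ?thesis unfolding k_def by linarith
qed

lemma odd_coloring_iff: "proper_odd_coloring = witness_coloring odd"
  by (intro ext) (simp add: proper_odd_coloring_def witness_coloring_def)

lemma cf_coloring_iff: "proper_cf_coloring = witness_coloring (\<lambda>n. n = 1)"
  by (intro ext) (simp add: proper_cf_coloring_def witness_coloring_def)

theorem lemma1p3:
  fixes G :: "('a, 'b) pre_digraph" and t :: int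
  assumes "graph G"
    and "arcs G \<noteq> {} \<or> (verts G \<noteq> {} \<and> t \<le> 1)"
  shows
    "((\<forall>H A B. induced_subgraph H G \<and> bipartite_graph H A B \<longrightarrow>
         (\<exists>c. proper_odd_coloring H c \<and> int (card (c ` A)) \<le> t \<and> int (card (c ` B)) \<le> t))
      \<longrightarrow> int (odd_chromatic_number G) \<le> t\<^sup>2 * int (chromatic_number G) - 2 * t * (t - 1))
     \<and>
     ((\<forall>H A B. induced_subgraph H G \<and> bipartite_graph H A B \<longrightarrow>
         (\<exists>c. proper_cf_coloring H c \<and> int (card (c ` A)) \<le> t \<and> int (card (c ` B)) \<le> t))
      \<longrightarrow> int (pcf_chromatic_number G) \<le> t\<^sup>2 * int (chromatic_number G) - 2 * t * (t - 1))"
proof -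
  interpret graph G by fact
  have "splitting odd" "splitting (\<lambda>n. n = 1)" by (auto simp: splitting_def)
  then show ?thesis
    unfolding odd_chromatic_number_def pcf_chromatic_number_def odd_coloring_iff cf_coloring_iff
    using witness_chromatic_bound assms(2) by blast
qed

end
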